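(* Let $A=M_n(\mathbb{C})$, let $\psi$ be a state on $A$, let $a\in A_{sa}$, and let $\Delta\subseteq\mathbb{R}$ be open with $\chi_\Delta(a)\neq 0$. Define $\underline{[a\in\Delta]}$ using $\delta^{o}(\chi_{\Delta}(a))$, and remove the trivial context $\mathbb{C}=\mathbb{C}1$ from $\mathcal{C}$. Then for every $C$ in the resulting poset $\mathcal{C}$, the following two conditions are equivalent in the contravariant model: 1. $C\Vdash\underline{\mu}(\neg\underline{[a\in\Delta]})=\underline{1}$; 2. There exists a projection $p\in C$ that generates $C$ and satisfies $p\geq\chi_{\Delta}(a)$ as well as $\psi(p)=0$.
   Context: Contravariant model: $\mathcal{C}$ is here the poset (under inclusion) of abelian von Neumann subalgebras of $A$ containing the unit of $A$, with the trivial algebra $\mathbb{C}1$ removed; the topos is $[\mathcal{C}^{op},\mathbf{Set}]$. $\Sigma_C$ is the Gelfand spectrum of $C$. $\Sigma_{\downarrow}=\coprod_{C\in\mathcal{C}}\Sigma_C$ with $U$ open iff (1) $(C,\lambda)\in U$ and $D\subseteq C$ ($D\in\mathcal{C}$) imply $(D,\lambda|_D)\in U$, and (2) $U_C:=U\cap\Sigma_C$ is open in $\Sigma_C$ for all $C$. $\mathcal{O}\Sigma_{\downarrow}$ is a complete Heyting algebra under inclusion, and $\neg$ is its negation; explicitly, for $U=[a\in\Delta]$, $(\neg U)_C=\{\lambda\in\Sigma_C\mid\forall D\in\mathcal{C},\ D\subseteq C:\ \lambda|_D\notin U_D\}$. For a projection $p\in A$, $\delta^o(p)_C=\bigwedge\{q\in\mathrm{Proj}(C)\mid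 q\geq p\}$. The elementary proposition $\underline{[a\in\Delta]}$ is (externally) the open $[a\in\Delta]=\{(C,\lambda)\in\Sigma_{\downarrow}\mid\lambda(\delta^o(\chi_\Delta(a))_C)=1\}$, where $\chi_\Delta(a)$ is the spectral projection. A projection $p$ generates $C$ if $C$ is the von Neumann algebra generated by $p$ and $1$. $\underline{\mu}$ is the internal probability valuation associated to $\psi$: externally $\mu(U)(C)=\mu^{C}(U_C)$ for $U\in\mathcal{O}\Sigma_{\downarrow}$, with $\mu^C:\mathcal{O}\Sigma_C\to[0,1]$ the probability valuation corresponding to $\psi|_C$ by Riesz–Markov (so if $U_C$ is the clopen set corresponding to the projection $p_C\in C$, then $\mu(U)(C)=\psi(p_C)$). By presheaf semantics, $C\Vdash\underline{\mu}(\underline{U})=\underline{1}$ means $\mu(U)(D)=1$ for all $D\in\mathcal{C}$ with $D\subseteq C$. *)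

theory Defs
  imports "HOL-Probability.Probability_Measure"
begin

type_synonym 'n cmat = "complex ^ 'n ^ 'n"

definition cscale :: "complex \<Rightarrow> 'n::finite cmat \<Rightarrow> 'n cmat" where
  "cscale z x = map_matrix ((*) z) x"

definition adj :: "'n::finite cmat \<Rightarrow> 'n cmat" where
  "adj x = map_matrix cnj (transpose x)"

definition selfadj :: "'n::finite cmat \<Rightarrow> bool" where
  "selfadj x \<longleftrightarrow> adj x = x"

definition pos :: "'n::finite cmat \<Rightarrow> bool" where
  "pos x \<longleftrightarrow> (\<exists>y. x = adj y ** y)"

definition le_op :: "'n::finite cmat \<Rightarrow> 'n cmat \<Rightarrow> bool"  (infix \<open>\<preceq>\<close> 50) where
  "x \<preceq> y \<longleftrightarrow> pos (y - x)"

definition projection :: "'n::finite cmat \<Rightarrow> bool" where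
  "projection p \<longleftrightarrow> selfadj p \<and> p ** p = p"

definition state :: "('n::finite cmat \<Rightarrow> complex) \<Rightarrow> bool" where
  "state \<psi> \<longleftrightarrow>
     (\<forall>x y. \<psi> (x + y) = \<psi> x + \<psi> y) \<and> (\<forall>z x. \<psi> (cscale z x) = z * \<psi> x) \<and>
     (\<forall>x. pos x \<longrightarrow> \<psi> x \<in> \<real>\<^sub>\<ge>\<^sub>0) \<and> \<psi> (mat 1) = 1"

definition spectrum :: "'n::finite cmat \<Rightarrow> complex set" where
  "spectrum a = {z. \<not> invertible (a - mat z)}"

definition eigenproj :: "'n::finite cmat \<Rightarrow> real \<Rightarrow> 'n cmat" where
  "eigenproj a t = (THE p. projection p \<and> range ((*v) p) = {v. a *v v = complex_of_real t *s v})"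

text \<open>Functional calculus of a self-adjoint matrix, whose spectrum is a finite set of reals.
  The spectral projection \<open>\<chi>\<^sub>\<Delta>(a)\<close> is the case where \<open>f\<close> is the indicator function of \<open>\<Delta>\<close>.\<close>

definition fun_calc :: "(real \<Rightarrow> real) \<Rightarrow> 'n::finite cmat \<Rightarrow> 'n cmat" where
  "fun_calc f a = (\<Sum>t\<in>{t. complex_of_real t \<in> spectrum a}. f t *\<^sub>R eigenproj a t)"

definition spectral_proj :: "real set \<Rightarrow> 'n::finite cmat \<Rightarrow> 'n cmat" where
  "spectral_proj \<Delta> a = fun_calc (indicator \<Delta>) a"

definition commutant :: "'n::finite cmat set \<Rightarrow> 'n cmat set" where
  "commutant S = {x. \<forall>y\<in>S. x ** y = y ** x}"

definition vN_algebra :: "'n::finite cmat set \<Rightarrow> bool" where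
  "vN_algebra M \<longleftrightarrow>
     mat 1 \<in> M \<and>
     (\<forall>x\<in>M. \<forall>y\<in>M. x + y \<in> M \<and> x ** y \<in> M) \<and>
     (\<forall>x\<in>M. adj x \<in> M \<and> (\<forall>z. cscale z x \<in> M)) \<and>
     commutant (commutant M) = M"

definition vN_generated :: "'n::finite cmat set \<Rightarrow> 'n cmat set" where
  "vN_generated S = \<Inter>{M. vN_algebra M \<and> S \<subseteq> M}"

definition generates :: "'n::finite cmat \<Rightarrow> 'n cmat set \<Rightarrow> bool" where
  "generates p C \<longleftrightarrow> vN_generated {p, mat 1} = C"

text \<open>The poset \<open>\<C>\<close>, ordered by inclusion; \<open>range mat\<close> is the trivial algebra of
  scalar matrices.\<close>

definition contexts :: "'n::finite cmat set set" where
  "contexts = {C. vN_algebra C \<and> (\<forall>x\<in>C. \<forall>y\<in>C. x ** y = y ** x) \<and> C \<noteq> range mat}"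

definition Proj :: "'n::finite cmat set \<Rightarrow> 'n cmat set" where
  "Proj C = {p \<in> C. projection p}"

text \<open>Outer daseinisation: the infimum, in the complete lattice \<open>Proj C\<close>, of the projections
  of \<open>C\<close> that lie above \<open>p\<close>.\<close>

definition outer_das :: "'n::finite cmat \<Rightarrow> 'n cmat set \<Rightarrow> 'n cmat" where
  "outer_das p C = (THE r. r \<in> Proj C \<and> (\<forall>q\<in>Proj C. p \<preceq> q \<longrightarrow> r \<preceq> q) \<and>
     (\<forall>s\<in>Proj C. (\<forall>q\<in>Proj C. p \<preceq> q \<longrightarrow> s \<preceq> q) \<longrightarrow> s \<preceq> r))"

text \<open>Characters of \<open>C\<close> are represented as functions that are \<open>undefined\<close> outside \<open>C\<close>, so that
  restricting a character to \<open>D \<subseteq> C\<close> is \<open>restrict \<lambda> D\<close>, and the weak-* topology is a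
  subspace of the product topology over the index set \<open>C\<close>.\<close>

definition gelfand :: "'n::finite cmat set \<Rightarrow> ('n cmat \<Rightarrow> complex) set" where
  "gelfand C = {l \<in> extensional C.
     (\<forall>x\<in>C. \<forall>y\<in>C. l (x + y) = l x + l y \<and> l (x ** y) = l x * l y) \<and>
     (\<forall>z. \<forall>x\<in>C. l (cscale z x) = z * l x) \<and> l (mat 1) = 1}"

definition gelfand_topology :: "'n::finite cmat set \<Rightarrow> ('n cmat \<Rightarrow> complex) topology" where
  "gelfand_topology C = subtopology (product_topology (\<lambda>_. euclidean) C) (gelfand C)"

type_synonym 'n point = "'n cmat set \<times> ('n cmat \<Rightarrow> complex)"

definition Sigma_down :: "'n::finite point set" where
  "Sigma_down = (SIGMA C:contexts. gelfand C)"

definition fibre :: "'n::finite point set \<Rightarrow> 'n cmat set \<Rightarrow> ('n cmat \<Rightarrow> complex) set" where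
  "fibre U C = {l. (C, l) \<in> U}"

definition opens :: "'n::finite point set set" where
  "opens = {U. U \<subseteq> Sigma_down \<and>
     (\<forall>C l D. (C, l) \<in> U \<longrightarrow> D \<in> contexts \<longrightarrow> D \<subseteq> C \<longrightarrow> (D, restrict l D) \<in> U) \<and>
     (\<forall>C\<in>contexts. openin (gelfand_topology C) (fibre U C))}"

text \<open>Negation in the complete Heyting algebra \<open>opens\<close>: the largest open disjoint from \<open>U\<close>.\<close>

definition neg :: "'n::finite point set \<Rightarrow> 'n point set" where
  "neg U = \<Union>{V \<in> opens. V \<inter> U = {}}"

definition elem_prop :: "'n::finite cmat \<Rightarrow> real set \<Rightarrow> 'n point set" where
  "elem_prop a \<Delta> = {(C, l) \<in> Sigma_down. l (outer_das (spectral_proj \<Delta> a) C) = 1}"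

text \<open>The Riesz-Markov measure of the restriction of \<open>\<psi>\<close> to \<open>C\<close>. As \<open>C\<close> has finite dimension,
  its Gelfand spectrum is finite and discrete, so regularity is automatic.\<close>

definition riesz_measure ::
    "('n::finite cmat \<Rightarrow> complex) \<Rightarrow> 'n cmat set \<Rightarrow> ('n cmat \<Rightarrow> complex) measure" where
  "riesz_measure \<psi> C = (THE M. prob_space M \<and> space M = gelfand C \<and>
     sets M = sigma_sets (gelfand C) {U. openin (gelfand_topology C) U} \<and>
     (\<forall>x\<in>C. (\<integral>l. l x \<partial>M) = \<psi> x))"

definition mu ::
    "('n::finite cmat \<Rightarrow> complex) \<Rightarrow> 'n point set \<Rightarrow> 'n cmat set \<Rightarrow> real" where
  "mu \<psi> U C = measure (riesz_measure \<psi> C) (fibre U C)"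

text \<open>Presheaf semantics of the equality of two internal reals, given externally as functions on
  \<open>contexts\<close>: they agree at every stage below \<open>C\<close>.\<close>

definition forces_eq ::
    "'n::finite cmat set \<Rightarrow> ('n cmat set \<Rightarrow> real) \<Rightarrow> ('n cmat set \<Rightarrow> real) \<Rightarrow> bool" where
  "forces_eq C r s \<longleftrightarrow> (\<forall>D\<in>contexts. D \<subseteq> C \<longrightarrow> r D = s D)"

end

theory Submission
  imports Defs
begin

text \<open>Let \<open>e = \<chi>\<^sub>\<Delta>(a)\<close> and suppose that the stalk of the negation at \<open>C\<close> contains a character
  \<open>l\<close>. Every nontrivial projection \<open>q \<in> C\<close> spans with \<open>1\<close> a two-dimensional context below \<open>C\<close>,
  whose daseinisation of \<open>e\<close> is \<open>q\<close>, \<open>1 - q\<close> or \<open>1\<close>; since \<open>l\<close> must vanish on it, either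
  \<open>l q = 0\<close> and \<open>e \<le> q\<close>, or \<open>l q = 1\<close> and \<open>e \<le> 1 - q\<close>. As \<open>e \<noteq> 0\<close>, this allows only one
  nontrivial projection \<open>p\<close> with \<open>l p = 0\<close>, so \<open>C\<close> is spanned by \<open>1\<close> and \<open>p\<close>, and \<open>e \<le> p\<close>. For
  such a \<open>C\<close> the stalk consists of the single character vanishing on \<open>p\<close>, whose mass is
  \<open>\<psi>(1 - p)\<close>.\<close>

section \<open>Matrices and projections\<close>

lemma matrix_mul_distribs:
  fixes x y z :: "'n::finite cmat"
  shows "x ** (y + z) = x ** y + x ** z" "(x + y) ** z = x ** z + y ** z"
    and "x ** (y - z) = x ** y - x ** z" "(x - y) ** z = x ** z - y ** z"
  by (simp_all add: matrix_matrix_mult_def vec_eq_iff sum.distrib sum_subtractf algebra_simps)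

lemma matrix_mul_zero [simp]:
  fixes x :: "'n::finite cmat"
  shows "x ** 0 = 0" "0 ** x = 0"
  by (simp_all add: matrix_matrix_mult_def vec_eq_iff)

lemma cscale_nth [simp]: "cscale z x $ i $ j = z * (x $ i $ j)"
  by (simp add: cscale_def map_matrix_def)

lemma cscale_mult [simp]:
  "cscale z x ** y = cscale z (x ** y)" "x ** cscale z y = cscale z (x ** y)"
  by (simp_all add: matrix_matrix_mult_def vec_eq_iff sum_distrib_left mult_ac)

lemma cscale_algebra:
  "cscale z (x + y) = cscale z x + cscale z y" "cscale z (x - y) = cscale z x - cscale z y"
  "cscale (z + w) x = cscale z x + cscale w x" "cscale (z - w) x = cscale z x - cscale w x"
  by (simp_all add: vec_eq_iff algebra_simps)

lemma cscale_simps [simp]: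
  "cscale z (cscale w x) = cscale (z * w) x" "cscale 0 x = 0" "cscale 1 x = x" "cscale z 0 = 0"
  by (simp_all add: vec_eq_iff mult.assoc)

lemma cscale_vec [simp]: "cscale z x *v v = z *s (x *v v)"
  by (simp add: matrix_vector_mult_def vec_eq_iff sum_distrib_left mult_ac)

lemma mat_eq_cscale: "mat z = (cscale z (mat 1) :: 'n::finite cmat)"
  by (simp add: vec_eq_iff mat_def)

lemma cscale_eq_0_iff [simp]: "cscale z x = 0 \<longleftrightarrow> z = 0 \<or> x = 0"
  by (auto simp: vec_eq_iff)

lemma adj_nth [simp]: "adj x $ i $ j = cnj (x $ j $ i)"
  by (simp add: adj_def map_matrix_def transpose_def)

lemma adj_simps [simp]:
  "adj (x + y) = adj x + adj y" "adj (x - y) = adj x - adj y" "adj (adj x) = x"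
  "adj (cscale z x) = cscale (cnj z) (adj x)" "adj (mat 1) = mat 1" "adj 0 = 0"
  by (auto simp: vec_eq_iff mat_def)

lemma adj_mult [simp]: "adj (x ** y) = adj y ** adj x"
  by (simp add: matrix_matrix_mult_def vec_eq_iff mult_ac)

text \<open>The product \<open>\<bullet>\<close> is the real one, that is, the real part of the
  Hermitian product. Its real part alone still moves \<open>x\<close> across as the full conjugate
  transpose.\<close>

lemma inner_adj: "((x :: 'n::finite cmat) *v v) \<bullet> w = v \<bullet> (adj x *v w)"
proof -
  have "((x :: 'n::finite cmat) *v v) \<bullet> w = (\<Sum>i\<in>UNIV. \<Sum>j\<in>UNIV. Re (x $ i $ j * v $ j * cnj (w $ i)))"
    by (simp add: inner_vec_def matrix_vector_mult_def inner_complex_def sum_distrib_left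
        sum_distrib_right sum.distrib sum_subtractf algebra_simps)
  also have "\<dots> = (\<Sum>j\<in>UNIV. \<Sum>i\<in>UNIV. Re (x $ i $ j * v $ j * cnj (w $ i)))"
    by (rule sum.swap)
  also have "\<dots> = v \<bullet> (adj x *v w)"
    by (simp add: inner_vec_def matrix_vector_mult_def inner_complex_def sum_distrib_left
        sum_distrib_right sum.distrib sum_subtractf algebra_simps)
  finally show ?thesis .
qed

lemma matrix_eqI: "(\<And>v. x *v v = y *v v) \<Longrightarrow> x = (y :: 'n::finite cmat)"
  by (simp add: matrix_eq)

lemma adj_eqI:
  assumes "\<And>v w. (x *v v) \<bullet> w = v \<bullet> (y *v w)"
  shows "y = adj (x :: 'n::finite cmat)"
proof (rule matrix_eqI)
  fix w
  have "v \<bullet> (y *v w - adj x *v w) = 0" for v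
    using assms[of v w] by (simp add: inner_adj inner_diff_right)
  from this[of "y *v w - adj x *v w"] show "y *v w = adj x *v w" by simp
qed

section \<open>Projections and their ranges\<close>

lemma projectionD:
  assumes "projection p"
  shows "adj p = p" "p ** p = p"
  using assms by (auto simp: projection_def selfadj_def)

lemma projectionD_assoc: "projection p \<Longrightarrow> p ** (p ** x) = p ** x"
  by (simp add: matrix_mul_assoc projectionD)

lemma projection_vec: "projection p \<Longrightarrow> p *v (p *v v) = p *v v"
  by (simp add: matrix_vector_mul_assoc projectionD)

lemma projection_trivial [simp]: "projection 0" "projection (mat 1)"
  by (simp_all add: projection_def selfadj_def)

lemma projection_compl: "projection p \<Longrightarrow> projection (mat 1 - p)"
  by (simp add: projection_def selfadj_def matrix_mul_distribs)

lemma projection_mult: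
  assumes "projection p" "projection q" "p ** q = q ** p"
  shows "projection (p ** q)"
proof -
  have "p ** q ** (p ** q) = p ** (q ** q) ** p"
    using assms(3) by (metis matrix_mul_assoc)
  then show ?thesis
    using assms unfolding projection_def selfadj_def by (metis adj_mult matrix_mul_assoc)
qed

lemma projection_range: "projection p \<Longrightarrow> v \<in> range ((*v) p) \<longleftrightarrow> p *v v = v"
  by (metis projection_vec rangeE rangeI)

text \<open>Each projection fixes the range of the other, so \<open>p ** q = q\<close> and
  \<open>q ** p = p\<close>; the adjoint of the first equation reads
  \<open>q ** p = q\<close>.\<close>

lemma projection_eqI:
  assumes "projection p" "projection q" "range ((*v) p) = range ((*v) q)"
  shows "p = q"
proof -
  have "p *v (q *v v) = q *v v" "q *v (p *v v) = p *v v" for v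
    using assms projection_range by blast+
  then have "p ** q = q" "q ** p = p"
    by (auto simp: matrix_eq matrix_vector_mul_assoc[symmetric])
  then show ?thesis
    by (metis adj_mult assms(1,2) projectionD(1))
qed

text \<open>Orthogonal projection onto \<open>S\<close>, taken as a real subspace. Since
  \<open>S\<close> is closed under complex scalars, real orthogonality to \<open>S\<close> is
  Hermitian orthogonality and the projection is complex linear.\<close>

lemma projection_onto_exists:
  fixes S :: "(complex ^ 'n::finite) set"
  assumes "0 \<in> S" and add: "\<And>v w. v \<in> S \<Longrightarrow> w \<in> S \<Longrightarrow> v + w \<in> S"
    and scale: "\<And>z v. v \<in> S \<Longrightarrow> z *s v \<in> S"
  shows "\<exists>p. projection p \<and> range ((*v) p) = S"
proof -
  have scaleR: "r *\<^sub>R v = complex_of_real r *s v" for r and v :: "complex ^ 'n"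
    by (simp add: vec_eq_iff) (simp add: scaleR_conv_of_real)
  have diff: "v - w \<in> S" if "v \<in> S" "w \<in> S" for v w
    using add[OF that(1) scale[OF that(2), of "-1"]] by simp
  have "subspace S"
    using assms by (auto simp: subspace_def scaleR)
  then have span: "span S = S" by (simp add: span_eq_iff)
  have "\<exists>y. y \<in> S \<and> (\<forall>s\<in>S. (x - y) \<bullet> s = 0)" for x
    using orthogonal_subspace_decomp_exists[of S x] unfolding span orthogonal_def
    by (metis add_diff_cancel_left')
  then obtain f where f: "\<And>x. f x \<in> S" "\<And>x s. s \<in> S \<Longrightarrow> (x - f x) \<bullet> s = 0"
    by metis
  \<comment> \<open>Additivity, homogeneity, idempotence and the action on \<open>S\<close> all
    follow by checking that a candidate has the defining property of \<open>f x\<close>.\<close>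
  have uniq: "f x = y" if "y \<in> S" "\<And>s. s \<in> S \<Longrightarrow> (x - y) \<bullet> s = 0" for x y
  proof -
    have "(f x - y) \<bullet> (f x - y) = (x - y) \<bullet> (f x - y) - (x - f x) \<bullet> (f x - y)"
      by (simp add: algebra_simps)
    then show ?thesis using f(2) that(2) diff[OF f(1) that(1)] by simp
  qed
  \<comment> \<open>A complex factor moves across as its conjugate, and \<open>cnj z *s s\<close>
    stays in \<open>S\<close>; this is where complex homogeneity comes from.\<close>
  have inner_scale: "(z *s v) \<bullet> w = v \<bullet> (cnj z *s w)" for z and v w :: "complex ^ 'n"
    by (simp add: inner_vec_def inner_complex_def algebra_simps)
  have "f (x + y) = f x + f y" for x y
  proof (rule uniq)
    fix s assume "s \<in> S"
    have "(x + y - (f x + f y)) \<bullet> s = (x - f x) \<bullet> s + (y - f y) \<bullet> s"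
      by (simp add: inner_diff_left inner_add_left)
    then show "(x + y - (f x + f y)) \<bullet> s = 0"
      by (simp only: f(2)[OF \<open>s \<in> S\<close>] add_0)
  qed (intro add f)
  moreover have "f (z *s x) = z *s f x" for z x
  proof (rule uniq)
    fix s assume "s \<in> S"
    have "(z *s x - z *s f x) \<bullet> s = (x - f x) \<bullet> (cnj z *s s)"
      unfolding inner_scale[symmetric] vec.scale_right_diff_distrib ..
    then show "(z *s x - z *s f x) \<bullet> s = 0"
      using f(2)[OF scale[OF \<open>s \<in> S\<close>]] by (rule trans)
  qed (rule scale[OF f(1)])
  ultimately have "Vector_Spaces.linear (*s) (*s) f"
    by unfold_locales (auto simp: vec.scale_right_distrib vec.scale_left_distrib)
  then have p: "matrix f *v x = f x" for x
    by (rule matrix_works)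
  have "f (f x) = f x" for x
    by (rule uniq) (use f in auto)
  then have idem: "matrix f ** matrix f = matrix f"
    by (simp add: matrix_eq matrix_vector_mul_assoc[symmetric] p)
  have "f x \<bullet> y = x \<bullet> f y" for x y
    using f(2)[of "f x" y] f(2)[of "f y" x] f(1)
    by (simp add: inner_diff_left) (metis inner_commute)
  then have "adj (matrix f) = matrix f"
    by (intro adj_eqI[symmetric]) (simp add: p)
  moreover have "range ((*v) (matrix f)) = S"
  proof -
    have "f x = x" if "x \<in> S" for x
      by (rule uniq) (simp_all add: that)
    then show ?thesis using f(1) by (auto simp: p image_iff) metis
  qed
  ultimately show ?thesis
    using idem unfolding projection_def selfadj_def by blast
qed

section \<open>Eigenprojections and spectral projections\<close>

text \<open>Justifies the \<open>THE\<close> in \<open>eigenproj\<close>: an eigenspace is a complex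
  subspace, and a projection is determined by its range. If \<open>t\<close> is not an eigenvalue,
  the projection is \<open>0\<close>.\<close>

lemma eigenproj:
  shows projection_eigenproj [simp]: "projection (eigenproj a t)"
    and range_eigenproj: "range ((*v) (eigenproj a t)) = {v. a *v v = complex_of_real t *s v}"
proof -
  let ?P = "\<lambda>p. projection p \<and> range ((*v) p) = {v. a *v v = complex_of_real t *s v}"
  have "\<exists>p. ?P p"
    by (rule projection_onto_exists)
      (auto simp: matrix_vector_right_distrib vec.scale_right_distrib vector_scalar_commute mult_ac)
  then have "\<exists>!p. ?P p"
    by (metis projection_eqI)
  from theI'[OF this] show "projection (eigenproj a t)"
    "range ((*v) (eigenproj a t)) = {v. a *v v = complex_of_real t *s v}"
    by (auto simp: eigenproj_def)
qed

lemma eigenproj_vec_iff: "eigenproj a t *v v = v \<longleftrightarrow> a *v v = complex_of_real t *s v"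
  using projection_range[OF projection_eigenproj, of v a t] by (simp add: range_eigenproj)

lemma mult_eigenproj: "a ** eigenproj a t = cscale (complex_of_real t) (eigenproj a t)"
  by (rule matrix_eqI)
    (simp add: matrix_vector_mul_assoc[symmetric] eigenproj_vec_iff[THEN iffD1] projection_vec)

lemma eigenproj_mult:
  assumes "selfadj a"
  shows "eigenproj a t ** a = cscale (complex_of_real t) (eigenproj a t)"
  using arg_cong[OF mult_eigenproj[of a t], of adj] assms
  by (simp add: projectionD selfadj_def)

text \<open>Evaluate \<open>eigenproj a s ** a ** eigenproj a t\<close> in both ways:
  \<open>a\<close> becomes the factor \<open>s\<close> on the left and \<open>t\<close> on the
  right.\<close>

lemma eigenproj_orth:
  assumes "selfadj a" "s \<noteq> t"
  shows "eigenproj a s ** eigenproj a t = 0"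
proof -
  have "cscale (complex_of_real s) (eigenproj a s ** eigenproj a t) = eigenproj a s ** a ** eigenproj a t"
    using assms by (simp add: eigenproj_mult)
  also have "\<dots> = cscale (complex_of_real t) (eigenproj a s ** eigenproj a t)"
    by (simp add: matrix_mul_assoc[symmetric] mult_eigenproj)
  finally have "cscale (complex_of_real s - complex_of_real t) (eigenproj a s ** eigenproj a t) = 0"
    by (simp add: cscale_algebra)
  then show ?thesis using assms by simp
qed

lemma matrix_mul_sum_right:
  fixes x :: "'n::finite cmat" and f :: "'a \<Rightarrow> 'n cmat"
  shows "x ** (\<Sum>t\<in>T. f t) = (\<Sum>t\<in>T. x ** f t)"
  by (induction T rule: infinite_finite_induct) (simp_all add: matrix_mul_distribs)

lemma projection_sum:
  assumes "finite T" "\<And>t. t \<in> T \<Longrightarrow> projection (f t)"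
    and "\<And>s t. s \<in> T \<Longrightarrow> t \<in> T \<Longrightarrow> s \<noteq> t \<Longrightarrow> f s ** f t = 0"
  shows "projection (\<Sum>t\<in>T. f t)"
  using assms
proof (induction T rule: finite_induct)
  case (insert x F)
  have p: "projection (sum f F)" "projection (f x)"
    using insert.IH insert.prems by simp_all
  have "f x ** f t = 0" if "t \<in> F" for t
    using insert.hyps(2) insert.prems(2)[of x t] that by blast
  then have 0: "f x ** sum f F = 0"
    by (simp add: matrix_mul_sum_right)
  from arg_cong[OF 0, of adj] p have "sum f F ** f x = 0" by (simp add: projectionD)
  with p 0 have "projection (f x + sum f F)"
    by (simp add: projection_def selfadj_def matrix_mul_distribs)
  then show ?case using insert.hyps by simp
qed simp

text \<open>A sum over an infinite set is \<open>0\<close>, so finiteness of the spectrum need not be proved.\<close>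

lemma projection_spectral_proj:
  assumes "selfadj a"
  shows "projection (spectral_proj \<Delta> a)"
proof (cases "finite {t. complex_of_real t \<in> spectrum a}")
  case True
  have "spectral_proj \<Delta> a = (\<Sum>t\<in>{t. complex_of_real t \<in> spectrum a} \<inter> \<Delta>. eigenproj a t)"
    unfolding spectral_proj_def fun_calc_def sum.inter_restrict[OF True]
    by (rule sum.cong) (auto simp: indicator_def)
  then show ?thesis
    using True assms by (simp add: projection_sum eigenproj_orth)
qed (simp add: spectral_proj_def fun_calc_def)

section \<open>Order of projections, and eigenvectors in invariant subspaces\<close>

lemma pos_projection: "projection p \<Longrightarrow> pos p"
  unfolding pos_def by (metis projectionD)

text \<open>Turns the order into an equation. If \<open>q - p = adj y ** y\<close> and
  \<open>q\<close> kills \<open>w\<close>, then the squared norm of \<open>p *v w\<close> is minus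
  that of \<open>y *v w\<close>, so \<open>p\<close> kills \<open>w\<close>. Hence \<open>p\<close>
  vanishes on the range of \<open>mat 1 - q\<close>.\<close>

lemma le_op_projection_iff:
  assumes "projection p" "projection q"
  shows "p \<preceq> q \<longleftrightarrow> q ** p = p"
proof
  assume *: "q ** p = p"
  from arg_cong[OF *, of adj] have "p ** q = p" using assms by (simp add: projectionD)
  with * assms have "projection (q - p)"
    by (simp add: projection_def selfadj_def matrix_mul_distribs)
  then show "p \<preceq> q" by (simp add: le_op_def pos_projection)
next
  assume "p \<preceq> q"
  then obtain y where y: "q - p = adj y ** y" by (auto simp: le_op_def pos_def)
  have "p *v ((mat 1 - q) *v v) = 0" for v
  proof -
    define w where "w = (mat 1 - q) *v v"
    have "q *v w = 0"
      using assms by (simp add: w_def matrix_vector_mul_assoc matrix_mul_distribs projectionD)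
    have "(p *v w) \<bullet> (p *v w) = w \<bullet> (p *v w)"
      using assms by (simp add: inner_adj projectionD projection_vec)
    also have "\<dots> = - (w \<bullet> ((q - p) *v w))"
      using \<open>q *v w = 0\<close> by (simp add: matrix_vector_mult_diff_rdistrib)
    also have "w \<bullet> ((q - p) *v w) = (y *v w) \<bullet> (y *v w)"
      unfolding y by (simp add: inner_adj matrix_vector_mul_assoc)
    finally have "(p *v w) \<bullet> (p *v w) \<le> 0" by simp
    then have "(p *v w) \<bullet> (p *v w) = 0" by (intro antisym) simp_all
    then show ?thesis unfolding w_def[symmetric] by simp
  qed
  then have "p ** (mat 1 - q) = 0"
    by (simp add: matrix_eq matrix_vector_mul_assoc[symmetric])
  then have "p ** q = p" by (simp add: matrix_mul_distribs)
  from arg_cong[OF this, of adj] show "q ** p = p" using assms by (simp add: projectionD)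
qed

text \<open>A maximiser of the quadratic form of \<open>h\<close> on the unit sphere of the range of \<open>p\<close> is an
  eigenvector.\<close>

lemma selfadj_eigenvector:
  fixes h p :: "'n::finite cmat"
  assumes h: "selfadj h" and p: "projection p" "p \<noteq> 0" and hp: "h ** p = p ** h"
  shows "\<exists>t v. v \<noteq> 0 \<and> p *v v = v \<and> h *v v = complex_of_real t *s v"
proof -
  define S where "S = {v. p *v v = v}"
  define K where "K = S \<inter> sphere 0 1"
  have lin: "linear ((*v) p)" "linear ((*v) h)" by simp_all
  have sub: "subspace S"
    using lin(1) unfolding S_def subspace_def by (simp add: linear_add linear_cmul)
  have hS: "h *v v \<in> S" if "v \<in> S" for v
    using that hp unfolding S_def mem_Collect_eq by (metis matrix_vector_mul_assoc)
  have cont: "continuous_on A ((*v) x)" for A and x :: "'n cmat"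
    by (intro linear_continuous_on linear_linear[THEN iffD1]) simp
  have "compact K"
    unfolding K_def using closed_subspace[OF sub] by (simp add: closed_Int_compact)
  moreover obtain u where u: "p *v u \<noteq> 0"
    using p(2) by (metis matrix_eq matrix_vector_mult_0)
  have "(1 / norm (p *v u)) *\<^sub>R (p *v u) \<in> S"
    using sub p(1) by (intro subspace_scale) (auto simp: S_def projection_vec)
  then have "K \<noteq> {}" using u unfolding K_def by force
  moreover have "continuous_on K (\<lambda>v. (h *v v) \<bullet> v)"
    by (intro continuous_intros cont)
  ultimately obtain v where v: "v \<in> K" and max: "\<And>w. w \<in> K \<Longrightarrow> (h *v w) \<bullet> w \<le> (h *v v) \<bullet> v"
    using continuous_attains_sup[of K] by blast
  define t where "t = (h *v v) \<bullet> v"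
  \<comment> \<open>On \<open>S\<close> the form of \<open>g\<close> is nonnegative by maximality of
    \<open>t\<close>, and it vanishes at \<open>v\<close>. It remains to conclude
    \<open>g v = 0\<close>.\<close>
  define g where "g = (\<lambda>w. t *\<^sub>R w - h *v w)"
  have ling: "linear g" unfolding g_def
    by (intro linear_compose_sub lin linear_scaleR)
  have symg: "g x \<bullet> y = x \<bullet> g y" for x y
    using h unfolding g_def selfadj_def by (simp add: inner_diff inner_adj)
  have g_nonneg: "0 \<le> g w \<bullet> w" if "w \<in> S" for w
  proof (cases "w = 0")
    case False
    then have "(1 / norm w) *\<^sub>R w \<in> K"
      using that sub by (simp add: K_def subspace_scale)
    from max[OF this] have "((h *v w) \<bullet> w) / (norm w)\<^sup>2 \<le> t"
      using linear_cmul[OF lin(2)] by (simp add: t_def power2_eq_square)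
    then have "(h *v w) \<bullet> w \<le> t * (norm w)\<^sup>2"
      using False by (simp add: field_simps)
    then show ?thesis by (simp add: g_def inner_diff_left power2_norm_eq_inner)
  qed (simp add: g_def)
  have vS: "v \<in> S" "norm v = 1" using v by (auto simp: K_def)
  have gv: "g v \<bullet> v = 0"
    using vS(2) by (simp add: g_def inner_diff_left t_def norm_eq_1)
  define w where "w = g v"
  have wS: "w \<in> S"
    unfolding w_def g_def using sub vS hS by (intro subspace_diff subspace_scale) auto
  \<comment> \<open>The form of \<open>g\<close> at the perturbed vector \<open>v + s w\<close>.
    Both cross terms equal \<open>w \<bullet> w\<close> by symmetry of \<open>g\<close>.\<close>
  have quad: "0 \<le> 2 * s * (w \<bullet> w) + s\<^sup>2 * (g w \<bullet> w)" for s
  proof -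
    have "0 \<le> g (v + s *\<^sub>R w) \<bullet> (v + s *\<^sub>R w)"
      using sub vS wS by (intro g_nonneg subspace_add subspace_scale) auto
    also have "\<dots> = g v \<bullet> v + s * (g v \<bullet> w) + s * (g w \<bullet> v) + s\<^sup>2 * (g w \<bullet> w)"
      using ling by (simp add: linear_add linear_cmul inner_add_left inner_add_right power2_eq_square algebra_simps)
    also have "g w \<bullet> v = w \<bullet> w" by (simp add: symg w_def)
    finally show ?thesis using gv by (simp add: w_def[symmetric])
  qed
  have "w \<bullet> w = 0"
  proof (rule ccontr)
    assume "w \<bullet> w \<noteq> 0"
    then have pos: "w \<bullet> w > 0" by simp
    define c where "c = g w \<bullet> w"
    have c: "c \<ge> 0" unfolding c_def using wS by (rule g_nonneg)
    \<comment> \<open>A negative \<open>s\<close> so small that the linear term dominates: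
      \<open>s * c\<close> is at least \<open>- (w \<bullet> w)\<close>. The summand 1 keeps the
      denominator positive when \<open>c = 0\<close>.\<close>
    define s where "s = - (w \<bullet> w) / (c + 1)"
    have "s < 0" using pos c by (simp add: s_def field_simps)
    have "0 \<le> s * (2 * (w \<bullet> w) + s * c)"
      using quad[of s] by (simp add: c_def power2_eq_square algebra_simps)
    then have "2 * (w \<bullet> w) + s * c \<le> 0" using \<open>s < 0\<close> by (simp add: zero_le_mult_iff)
    moreover have "- (w \<bullet> w) \<le> s * c"
      using pos c by (simp add: s_def field_simps)
    ultimately show False using pos by simp
  qed
  then have "h *v v = t *\<^sub>R v" by (simp add: w_def g_def)
  also have "\<dots> = complex_of_real t *s v"
    by (simp add: vec_eq_iff) (simp add: scaleR_conv_of_real)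
  finally show ?thesis using vS unfolding S_def by (intro exI[of _ t] exI[of _ v]) auto
qed

section \<open>Abelian algebras generated by a projection\<close>

text \<open>The span of \<open>p\<close> and \<open>1\<close>, in the coordinates of the orthogonal
  idempotents \<open>p\<close> and \<open>1 - p\<close>, so that products are computed
  coordinatewise. For \<open>p = 0\<close> or \<open>p = 1\<close> it degenerates to the
  scalars.\<close>

definition two_dim :: "'n::finite cmat \<Rightarrow> 'n cmat set" where
  "two_dim p = {cscale z p + cscale w (mat 1 - p) |z w. True}"

lemma mat_1_neq_0 [simp]: "(mat 1 :: 'n::finite cmat) \<noteq> 0"
  by (simp add: vec_eq_iff mat_def)

lemma range_mat_iff: "x \<in> range mat \<longleftrightarrow> (\<exists>z. x = cscale z (mat 1 :: 'n::finite cmat))"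
  unfolding image_iff by (subst mat_eq_cscale) simp

lemma two_dim_mult:
  assumes "projection p"
  shows "(cscale z p + cscale w (mat 1 - p)) ** (cscale z' p + cscale w' (mat 1 - p)) =
    cscale (z * z') p + cscale (w * w') (mat 1 - p)"
proof -
  have "p ** (mat 1 - p) = 0" "(mat 1 - p) ** p = 0" "(mat 1 - p) ** (mat 1 - p) = mat 1 - p" "p ** p = p"
    using assms by (simp_all add: matrix_mul_distribs projectionD)
  then show ?thesis
    unfolding matrix_mul_distribs(1,2) cscale_mult by (simp add: mult.commute)
qed

lemma two_dim_memI: "cscale z p + cscale w (mat 1 - p) \<in> two_dim p"
  by (auto simp: two_dim_def)

lemma two_dim_generator: "p \<in> two_dim p"
  using two_dim_memI[of 1 p 0] by simp

lemma two_dim_compl: "two_dim (mat 1 - p) = two_dim p"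
  unfolding two_dim_def by (auto simp: add.commute)

lemma two_dim_commute:
  assumes "projection p" "x \<in> two_dim p" "y \<in> two_dim p"
  shows "x ** y = y ** x"
  using assms by (auto simp: two_dim_def two_dim_mult mult.commute)

text \<open>The rank-one operators on the range of \<open>q\<close> commute with \<open>q\<close>; commuting with all of them
  forces \<open>x\<close> to act on that range as a scalar.\<close>

lemma bicommutant_projection:
  assumes q: "projection q" and x: "\<And>y. y ** q = q ** y \<Longrightarrow> x ** y = y ** x"
  shows "\<exists>z. x ** q = cscale z (q :: 'n::finite cmat)"
proof (cases "q = 0")
  case False
  then obtain u where u: "q *v u \<noteq> 0" by (metis matrix_eq matrix_vector_mult_0)
  define w where "w = q *v u"
  have w: "w \<noteq> 0" "q *v w = w" using u q by (auto simp: w_def projection_vec)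
  \<comment> \<open>The complex Hermitian product, since the scalar by which \<open>x\<close> acts
    has to be read off exactly.\<close>
  define ip where "ip = (\<lambda>a b :: complex ^ 'n. \<Sum>i\<in>UNIV. a $ i * cnj (b $ i))"
  define R where "R = (\<lambda>v :: complex ^ 'n. \<chi> i j. v $ i * cnj (w $ j))"
  have R: "R v *v a = ip a w *s v" for v a
    by (simp add: R_def ip_def matrix_vector_mult_def vec_eq_iff sum_distrib_left sum_distrib_right mult_ac)
  have "ip w w = complex_of_real (\<Sum>i\<in>UNIV. (cmod (w $ i))\<^sup>2)"
    by (simp only: ip_def of_real_sum complex_norm_square)
  moreover have "(\<Sum>i\<in>UNIV. (cmod (w $ i))\<^sup>2) \<noteq> 0"
    using w(1) by (simp add: sum_nonneg_eq_0_iff vec_eq_iff)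
  ultimately have ww: "ip w w \<noteq> 0" by (metis of_real_eq_0_iff)
  have cnj_q: "cnj (q $ i $ j) = q $ j $ i" for i j
    using projectionD(1)[OF q] by (metis adj_nth)
  have "x ** q = cscale (ip (x *v w) w / ip w w) q"
  proof (rule matrix_eqI)
    fix a
    define v where "v = q *v a"
    have qv: "q *v v = v" using q by (simp add: v_def projection_vec)
    have ipq: "ip (q *v b) w = ip b w" for b
    proof -
      have "ip (q *v b) w = (\<Sum>i\<in>UNIV. \<Sum>j\<in>UNIV. q $ i $ j * b $ j * cnj (w $ i))"
        by (simp add: ip_def matrix_vector_mult_def sum_distrib_right)
      also have "\<dots> = (\<Sum>j\<in>UNIV. \<Sum>i\<in>UNIV. q $ i $ j * b $ j * cnj (w $ i))"
        by (rule sum.swap)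
      also have "\<dots> = ip b (q *v w)"
        by (simp add: ip_def matrix_vector_mult_def sum_distrib_left cnj_q mult_ac)
      finally show ?thesis by (simp add: w)
    qed
    \<comment> \<open>Both products equal \<open>R v\<close>, because \<open>v\<close> and
      \<open>w\<close> lie in the range of \<open>q\<close>. Applying
      \<open>x ** R v = R v ** x\<close> to \<open>w\<close> then expresses \<open>x *v v\<close> as
      a multiple of \<open>v\<close> whose factor does not depend on \<open>v\<close>.\<close>
    have "R v ** q = q ** R v"
      by (rule matrix_eqI) (simp add: matrix_vector_mul_assoc[symmetric] R ipq vector_scalar_commute qv)
    from x[OF this] have "x *v (R v *v w) = R v *v (x *v w)"
      by (simp add: matrix_vector_mul_assoc)
    then have *: "ip w w *s (x *v v) = ip (x *v w) w *s v"
      by (simp add: R vector_scalar_commute)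
    have "x *v v = (1 / ip w w) *s (ip w w *s (x *v v))"
      using ww by simp
    also have "\<dots> = (ip (x *v w) w / ip w w) *s v"
      unfolding * by simp
    finally show "(x ** q) *v a = cscale (ip (x *v w) w / ip w w) q *v a"
      by (simp add: v_def matrix_vector_mul_assoc[symmetric])
  qed
  then show ?thesis by blast
qed simp

text \<open>For the bicommutant, everything commuting with \<open>p\<close> lies in the commutant.
  An element of the bicommutant is therefore scalar on the ranges of \<open>p\<close> and of
  \<open>1 - p\<close>.\<close>

lemma vN_algebra_two_dim:
  assumes p: "projection p"
  shows "vN_algebra (two_dim p)"
  unfolding vN_algebra_def
proof (intro conjI ballI allI)
  show "mat 1 \<in> two_dim p"
    using two_dim_memI[of 1 p 1] by simp
  fix x y assume "x \<in> two_dim p" "y \<in> two_dim p"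
  then obtain z w z' w' where xy: "x = cscale z p + cscale w (mat 1 - p)"
    "y = cscale z' p + cscale w' (mat 1 - p)" by (auto simp: two_dim_def)
  have "x + y = cscale (z + z') p + cscale (w + w') (mat 1 - p)"
    by (simp add: xy cscale_algebra)
  then show "x + y \<in> two_dim p" by (simp add: two_dim_memI)
  show "x ** y \<in> two_dim p" unfolding xy two_dim_mult[OF p] by (rule two_dim_memI)
next
  fix x c assume "x \<in> two_dim p"
  then obtain z w where x: "x = cscale z p + cscale w (mat 1 - p)"
    by (auto simp: two_dim_def)
  have "adj x = cscale (cnj z) p + cscale (cnj w) (mat 1 - p)"
    using p by (simp add: x projectionD)
  then show "adj x \<in> two_dim p" by (simp add: two_dim_memI)
  have "cscale c x = cscale (c * z) p + cscale (c * w) (mat 1 - p)"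
    unfolding x cscale_algebra(1) by simp
  then show "cscale c x \<in> two_dim p" by (simp add: two_dim_memI)
next
  show "commutant (commutant (two_dim p)) = two_dim p"
  proof
    show "two_dim p \<subseteq> commutant (commutant (two_dim p))"
      unfolding commutant_def by fastforce
    show "commutant (commutant (two_dim p)) \<subseteq> two_dim p"
    proof
      fix x assume x: "x \<in> commutant (commutant (two_dim p))"
      have comm: "x ** y = y ** x" if "y ** p = p ** y" for y
      proof -
        have "y \<in> commutant (two_dim p)"
          using that by (auto simp: commutant_def two_dim_def matrix_mul_distribs)
        with x show ?thesis by (simp add: commutant_def)
      qed
      obtain z where z: "x ** p = cscale z p"
        using bicommutant_projection[OF p comm] by blast
      have "x ** y = y ** x" if "y ** (mat 1 - p) = (mat 1 - p) ** y" for y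
        using that by (intro comm) (simp add: matrix_mul_distribs)
      then obtain w where w: "x ** (mat 1 - p) = cscale w (mat 1 - p)"
        using bicommutant_projection[OF projection_compl[OF p]] by blast
      have "x = x ** p + x ** (mat 1 - p)"
        by (simp add: matrix_mul_distribs)
      then show "x \<in> two_dim p"
        unfolding z w by (metis two_dim_memI)
    qed
  qed
qed

lemma vN_algebraD:
  assumes "vN_algebra M"
  shows "mat 1 \<in> M" "x \<in> M \<Longrightarrow> y \<in> M \<Longrightarrow> x + y \<in> M" "x \<in> M \<Longrightarrow> y \<in> M \<Longrightarrow> x ** y \<in> M"
    and "x \<in> M \<Longrightarrow> adj x \<in> M" "x \<in> M \<Longrightarrow> cscale z x \<in> M"
  using assms by (auto simp: vN_algebra_def)

lemma vN_algebra_diff: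
  assumes "vN_algebra M" "x \<in> M" "y \<in> M"
  shows "x - y \<in> M"
proof -
  have "x - y = x + cscale (-1) y" by (simp add: vec_eq_iff)
  also have "\<dots> \<in> M" using assms by (intro vN_algebraD)
  finally show ?thesis .
qed

lemma range_mat_subset: "vN_algebra M \<Longrightarrow> range mat \<subseteq> M"
  unfolding subset_iff range_mat_iff by (auto simp: vN_algebraD)

lemma two_dim_subset: "vN_algebra M \<Longrightarrow> p \<in> M \<Longrightarrow> two_dim p \<subseteq> M"
  unfolding two_dim_def by (auto intro!: vN_algebraD vN_algebra_diff)

lemma generates_iff:
  assumes "projection p"
  shows "generates p C \<longleftrightarrow> C = two_dim p"
proof -
  have "vN_generated {p, mat 1} = two_dim p"
    unfolding vN_generated_def
    using vN_algebra_two_dim[OF assms] two_dim_subset two_dim_generator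
    by (intro antisym Inter_lower Inter_greatest) (auto intro: vN_algebraD)
  then show ?thesis by (auto simp: generates_def)
qed

text \<open>Multiplying \<open>r ** r = r\<close> by \<open>p\<close> and by \<open>1 - p\<close>
  separates the coordinates; each is then 0 or 1 unless its idempotent is zero.\<close>

lemma projection_two_dim:
  assumes p: "projection p" and r: "projection r" "r \<in> two_dim p"
  shows "r \<in> {0, p, mat 1 - p, mat 1}"
proof -
  obtain z w where rzw: "r = cscale z p + cscale w (mat 1 - p)"
    using r(2) by (auto simp: two_dim_def)
  have pp: "p ** p = p" "p ** (mat 1 - p) = 0" "(mat 1 - p) ** (mat 1 - p) = mat 1 - p"
    "(mat 1 - p) ** p = 0"
    using p by (simp_all add: matrix_mul_distribs projectionD)
  have eq: "cscale (z * z) p + cscale (w * w) (mat 1 - p) = cscale z p + cscale w (mat 1 - p)"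
    using projectionD(2)[OF r(1)] unfolding rzw two_dim_mult[OF p] .
  from arg_cong[OF eq, of "\<lambda>x. x ** p"] have "cscale (z * z - z) p = 0"
    unfolding matrix_mul_distribs(2) cscale_mult pp by (simp add: cscale_algebra)
  then have "cscale z p \<in> {0, p}" by auto
  moreover from arg_cong[OF eq, of "\<lambda>x. x ** (mat 1 - p)"]
  have "cscale (w * w - w) (mat 1 - p) = 0"
    unfolding matrix_mul_distribs(2) cscale_mult pp cscale_algebra(4) by simp
  then have "cscale w (mat 1 - p) \<in> {0, mat 1 - p}" by auto
  ultimately show ?thesis unfolding rzw by auto
qed

lemma two_dim_context:
  assumes "projection p" "p \<noteq> 0" "p \<noteq> mat 1"
  shows "two_dim p \<in> contexts"
proof -
  have "p \<notin> range mat"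
  proof
    assume "p \<in> range mat"
    then obtain z where z: "p = cscale z (mat 1)" by (auto simp: range_mat_iff)
    have "cscale (z * z - z) (mat 1 :: 'a cmat) = 0"
      using projectionD(2)[OF assms(1)] by (simp add: z cscale_algebra)
    then have "z = 0 \<or> z = 1" by simp
    with z assms show False by auto
  qed
  then show ?thesis
    using vN_algebra_two_dim two_dim_commute two_dim_generator assms(1)
    unfolding contexts_def by blast
qed

text \<open>With the scalars removed, these contexts are minimal: any non-scalar element of
  \<open>two_dim p\<close> gives back \<open>p\<close> by subtracting a scalar and rescaling. So
  forcing at such a context concerns a single stage.\<close>

lemma context_subset_two_dim:
  assumes p: "projection p" and D: "D \<in> contexts" "D \<subseteq> two_dim p"
  shows "D = two_dim p"
proof -
  have vN: "vN_algebra D" using D by (simp add: contexts_def)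
  with D obtain x where x: "x \<in> D" "x \<notin> range mat"
    using range_mat_subset unfolding contexts_def by blast
  then obtain z w where xzw: "x = cscale z p + cscale w (mat 1 - p)"
    using D by (auto simp: two_dim_def)
  have eq: "x - cscale w (mat 1) = cscale (z - w) p"
    by (simp add: xzw cscale_algebra)
  have "z \<noteq> w"
    using eq x(2) by (auto simp: range_mat_iff)
  then have "p = cscale (1 / (z - w)) (x - cscale w (mat 1))"
    unfolding eq by simp
  also have "\<dots> \<in> D"
    using vN x(1) by (intro vN_algebraD vN_algebra_diff)
  finally show ?thesis
    using two_dim_subset[OF vN] D by blast
qed

section \<open>Projections inside a context\<close>

text \<open>By the bicommutant property: whatever commutes with \<open>h\<close> preserves its
  eigenspaces, and so does its adjoint, so it commutes with the eigenprojections.\<close>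

lemma eigenproj_in_vN_algebra:
  assumes M: "vN_algebra M" and h: "h \<in> M" "selfadj h"
  shows "eigenproj h t \<in> M"
proof -
  let ?r = "eigenproj h t"
  have inv: "?r ** (y ** ?r) = y ** ?r" if "y ** h = h ** y" for y
  proof (rule matrix_eqI)
    fix v
    have "h *v (y *v (?r *v v)) = y *v (h *v (?r *v v))"
      by (metis matrix_vector_mul_assoc that)
    also have "h *v (?r *v v) = complex_of_real t *s (?r *v v)"
      by (simp add: eigenproj_vec_iff[THEN iffD1] projection_vec)
    finally have "?r *v (y *v (?r *v v)) = y *v (?r *v v)"
      by (simp add: eigenproj_vec_iff vector_scalar_commute)
    then show "(?r ** (y ** ?r)) *v v = (y ** ?r) *v v"
      by (simp add: matrix_vector_mul_assoc matrix_mul_assoc)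
  qed
  have "?r ** y = y ** ?r" if y: "y \<in> commutant M" for y
  proof -
    have "y ** h = h ** y" using y h by (simp add: commutant_def)
    from arg_cong[OF this, of adj] have "adj y ** h = h ** adj y"
      using h(2) by (simp add: selfadj_def)
    from arg_cong[OF inv[OF this], of adj] have "?r ** y ** ?r = ?r ** y"
      by (simp add: projectionD)
    moreover have "?r ** y ** ?r = y ** ?r"
      using inv[OF \<open>y ** h = h ** y\<close>] by (simp add: matrix_mul_assoc)
    ultimately show ?thesis by simp
  qed
  then have "?r \<in> commutant (commutant M)" by (simp add: commutant_def)
  with M show ?thesis by (simp add: vN_algebra_def)
qed

lemma selfadj_decomposition:
  assumes "vN_algebra M" "x \<in> M"
  obtains h k where "h \<in> M" "k \<in> M" "selfadj h" "selfadj k" "x = h + cscale \<i> k"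
proof
  define h where "h = cscale (1/2) (x + adj x)"
  define k where "k = cscale (-\<i>/2) (x - adj x)"
  show "h \<in> M" "k \<in> M"
    using assms unfolding h_def k_def by (auto intro!: vN_algebraD vN_algebra_diff)
  show "selfadj h" "selfadj k"
    by (auto simp: selfadj_def h_def k_def vec_eq_iff algebra_simps)
  show "x = h + cscale \<i> k"
    by (simp add: h_def k_def vec_eq_iff algebra_simps)
qed

text \<open>A non-scalar element has a non-scalar real or imaginary part \<open>y\<close>. The
  eigenprojection for an eigenvalue of \<open>y\<close> is nonzero, and it is not \<open>1\<close>
  because \<open>y\<close> would then be scalar.\<close>

lemma context_exists_projection:
  assumes "C \<in> contexts"
  shows "\<exists>p\<in>C. projection p \<and> p \<noteq> 0 \<and> p \<noteq> mat 1"
proof -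
  have C: "vN_algebra C" using assms by (simp add: contexts_def)
  obtain x where x: "x \<in> C" "x \<notin> range mat"
    using assms range_mat_subset[OF C] unfolding contexts_def by blast
  obtain h k where hk: "h \<in> C" "k \<in> C" "selfadj h" "selfadj k" "x = h + cscale \<i> k"
    using selfadj_decomposition[OF C x(1)] .
  have "\<exists>y\<in>C. selfadj y \<and> y \<notin> range mat"
  proof (rule ccontr)
    assume "\<not> ?thesis"
    then have "h \<in> range mat" "k \<in> range mat" using hk by auto
    then obtain z w where "h = cscale z (mat 1)" "k = cscale w (mat 1)"
      by (auto simp: range_mat_iff)
    then have "x = cscale (z + \<i> * w) (mat 1)" unfolding hk(5) by (simp add: cscale_algebra)
    with x(2) show False unfolding range_mat_iff by blast
  qed
  then obtain y where y: "y \<in> C" "selfadj y" "y \<notin> range mat" by blast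
  obtain t v where v: "v \<noteq> 0" "y *v v = complex_of_real t *s v"
    using selfadj_eigenvector[OF y(2), of "mat 1"] by auto
  have "eigenproj y t \<noteq> 0"
    using v eigenproj_vec_iff[of y t v] by auto
  moreover have "eigenproj y t \<noteq> mat 1"
    using mult_eigenproj[of y t] y(3) by (auto simp: range_mat_iff)
  ultimately show ?thesis
    using eigenproj_in_vN_algebra[OF C y(1,2)] projection_eigenproj by blast
qed

text \<open>An eigenvector of \<open>h\<close> in the range of \<open>q\<close> makes the product of
  \<open>q\<close> with that eigenprojection nonzero. By minimality the product is all of
  \<open>q\<close>, so \<open>h\<close> acts on that range by one eigenvalue.\<close>

lemma minimal_projection_scalar:
  assumes C: "C \<in> contexts" and q: "q \<in> C" "projection q" "q \<noteq> 0"
    and min: "\<And>r. r \<in> C \<Longrightarrow> projection r \<Longrightarrow> q ** r = r \<Longrightarrow> r \<in> {0, q}"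
    and h: "h \<in> C" "selfadj h"
  shows "\<exists>z. h ** q = cscale z q"
proof -
  have vN: "vN_algebra C" and comm: "\<And>x y. x \<in> C \<Longrightarrow> y \<in> C \<Longrightarrow> x ** y = y ** x"
    using C by (auto simp: contexts_def)
  obtain t v where v: "v \<noteq> 0" "q *v v = v" "h *v v = complex_of_real t *s v"
    using selfadj_eigenvector[OF h(2) q(2,3) comm[OF h(1) q(1)]] by blast
  define r where "r = eigenproj h t"
  have r: "r \<in> C" "projection r"
    using eigenproj_in_vN_algebra[OF vN h] by (simp_all add: r_def)
  have qr: "q ** r \<in> C" "projection (q ** r)"
    using r q vN comm by (auto intro!: vN_algebraD projection_mult)
  have "r *v v = v" using v by (simp add: r_def eigenproj_vec_iff)
  then have "(q ** r) *v v \<noteq> 0"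
    using v by (simp add: matrix_vector_mul_assoc[symmetric])
  then have "q ** r \<noteq> 0" by auto
  moreover have "q ** (q ** r) = q ** r" using q by (simp add: projectionD_assoc)
  ultimately have "q ** r = q" using min[OF qr] by simp
  then have "h ** q = h ** (r ** q)" using comm q(1) r(1) by metis
  also have "\<dots> = cscale (complex_of_real t) (r ** q)"
    by (simp add: matrix_mul_assoc mult_eigenproj r_def)
  also have "r ** q = q" using \<open>q ** r = q\<close> comm q(1) r(1) by metis
  finally show ?thesis by blast
qed

text \<open>The assumption \<open>min\<close> makes \<open>p\<close> and \<open>1 - p\<close>
  minimal in \<open>C\<close>, so every self-adjoint element is scalar on each; real and imaginary
  parts handle the rest.\<close>

lemma context_eq_two_dim:
  assumes C: "C \<in> contexts" and p: "p \<in> C" "projection p" "p \<noteq> 0" "p \<noteq> mat 1"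
    and min: "\<And>r. r \<in> C \<Longrightarrow> projection r \<Longrightarrow> r \<in> {0, p, mat 1 - p, mat 1}"
  shows "C = two_dim p"
proof
  have vN: "vN_algebra C" using C by (simp add: contexts_def)
  have pp: "p ** (mat 1 - p) = 0" "(mat 1 - p) ** p = 0"
    using p by (simp_all add: matrix_mul_distribs projectionD)
  have sa: "h \<in> two_dim p" if h: "h \<in> C" "selfadj h" for h
  proof -
    have "\<exists>z. h ** p = cscale z p"
    proof (rule minimal_projection_scalar[OF C p(1-3) _ h])
      fix r assume "r \<in> C" "projection r" "p ** r = r"
      then show "r \<in> {0, p}" using min[of r] pp by auto
    qed
    moreover have "\<exists>w. h ** (mat 1 - p) = cscale w (mat 1 - p)"
    proof (rule minimal_projection_scalar[OF C _ _ _ _ h])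
      show "mat 1 - p \<in> C" using vN p by (intro vN_algebra_diff vN_algebraD)
      fix r assume "r \<in> C" "projection r" "(mat 1 - p) ** r = r"
      then show "r \<in> {0, mat 1 - p}" using min[of r] pp by auto
    qed (use p projection_compl in auto)
    ultimately obtain z w where zw: "h ** p = cscale z p" "h ** (mat 1 - p) = cscale w (mat 1 - p)"
      by blast
    have "h = h ** p + h ** (mat 1 - p)" by (simp add: matrix_mul_distribs)
    then show ?thesis unfolding zw by (metis two_dim_memI)
  qed
  show "C \<subseteq> two_dim p"
  proof
    fix x assume "x \<in> C"
    then obtain h k where hk: "h \<in> C" "k \<in> C" "selfadj h" "selfadj k" "x = h + cscale \<i> k"
      using selfadj_decomposition[OF vN] by blast
    then show "x \<in> two_dim p"
      using sa vN_algebra_two_dim[OF p(2)] by (simp add: vN_algebraD)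
  qed
  show "two_dim p \<subseteq> C" using two_dim_subset[OF vN p(1)] .
qed

section \<open>Daseinisation in two-dimensional contexts\<close>

lemma le_op_antisym:
  assumes "projection p" "projection q" "p \<preceq> q" "q \<preceq> p"
  shows "p = q"
proof -
  have "q ** p = p" "p ** q = q" using assms by (simp_all add: le_op_projection_iff)
  from arg_cong[OF this(1), of adj] this(2) show ?thesis
    using assms by (simp add: projectionD)
qed

text \<open>Justifies the \<open>THE\<close> in \<open>outer_das\<close> when the infimum is
  attained: \<open>r\<close> itself lies above \<open>e\<close>, so every lower bound is below
  \<open>r\<close>.\<close>

lemma outer_das_eqI:
  assumes r: "r \<in> Proj C" "e \<preceq> r" and min: "\<And>q. q \<in> Proj C \<Longrightarrow> e \<preceq> q \<Longrightarrow> r \<preceq> q"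
  shows "outer_das e C = r"
  unfolding outer_das_def
proof (rule the_equality)
  fix s assume s: "s \<in> Proj C \<and> (\<forall>q\<in>Proj C. e \<preceq> q \<longrightarrow> s \<preceq> q) \<and>
     (\<forall>s'\<in>Proj C. (\<forall>q\<in>Proj C. e \<preceq> q \<longrightarrow> s' \<preceq> q) \<longrightarrow> s' \<preceq> s)"
  with assms have "s \<preceq> r" "r \<preceq> s" by auto
  with s r show "s = r" by (auto intro!: le_op_antisym simp: Proj_def)
qed (use assms in auto)

text \<open>Among \<open>0\<close>, \<open>q\<close>, \<open>1 - q\<close> and \<open>1\<close>, the
  candidates \<open>0\<close> and \<open>1 - q\<close> are excluded unless they coincide with one of
  the others: above \<open>e\<close> they would force \<open>e = 0\<close>.\<close>

lemma outer_das_two_dim_above: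
  assumes e: "projection e" "e \<noteq> 0" and q: "projection q" "e \<preceq> q"
  shows "outer_das e (two_dim q) = q"
proof (rule outer_das_eqI)
  show "q \<in> Proj (two_dim q)" using q by (simp add: Proj_def two_dim_generator)
  fix r assume r: "r \<in> Proj (two_dim q)" "e \<preceq> r"
  have "q ** e = e" using e q by (simp add: le_op_projection_iff)
  have "r ** e = e" using e r by (simp add: le_op_projection_iff Proj_def)
  then have "r \<noteq> 0" "r \<noteq> mat 1 - q"
    using \<open>q ** e = e\<close> e by (auto simp: matrix_mul_distribs)
  then have "r = q \<or> r = mat 1" using projection_two_dim[OF q(1)] r by (auto simp: Proj_def)
  then show "q \<preceq> r" using q by (auto simp: le_op_projection_iff projectionD)
qed (rule q)

lemma outer_das_two_dim_else:
  assumes e: "projection e" "e \<noteq> 0" and q: "projection q" "\<not> e \<preceq> q" "\<not> e \<preceq> mat 1 - q"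
  shows "outer_das e (two_dim q) = mat 1"
proof (rule outer_das_eqI)
  show "mat 1 \<in> Proj (two_dim q)"
    using vN_algebraD(1)[OF vN_algebra_two_dim[OF q(1)]] by (simp add: Proj_def)
  show "e \<preceq> mat 1" using e by (simp add: le_op_projection_iff)
  fix r assume r: "r \<in> Proj (two_dim q)" "e \<preceq> r"
  then have "r \<noteq> 0" using e by (auto simp: le_op_projection_iff)
  then have "r = mat 1" using projection_two_dim[OF q(1), of r] r q by (auto simp: Proj_def)
  then show "mat 1 \<preceq> r" by (simp add: le_op_projection_iff)
qed

section \<open>Characters, measures and negation\<close>

lemma contexts_vN_algebra: "C \<in> contexts \<Longrightarrow> vN_algebra C"
  by (simp add: contexts_def)

lemma gelfandD:
  assumes "l \<in> gelfand C"
  shows "l \<in> extensional C" "x \<in> C \<Longrightarrow> y \<in> C \<Longrightarrow> l (x + y) = l x + l y"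
    and "x \<in> C \<Longrightarrow> y \<in> C \<Longrightarrow> l (x ** y) = l x * l y"
    and "x \<in> C \<Longrightarrow> l (cscale z x) = z * l x" "l (mat 1) = 1"
  using assms by (auto simp: gelfand_def)

lemma gelfand_projection:
  assumes "l \<in> gelfand C" "p \<in> C" "projection p"
  shows "l p = 0 \<or> l p = 1"
  using gelfandD(3)[OF assms(1,2,2)] assms(3) by (simp add: projectionD)

lemma gelfand_compl:
  assumes "vN_algebra C" "l \<in> gelfand C" "p \<in> C"
  shows "l (mat 1 - p) = 1 - l p"
proof -
  have "mat 1 - p \<in> C" using assms by (intro vN_algebra_diff vN_algebraD)
  from gelfandD(2)[OF assms(2,3) this] gelfandD(5)[OF assms(2)] show ?thesis
    by (simp add: algebra_simps)
qed

lemma gelfand_restrict: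
  assumes "l \<in> gelfand C" "D \<subseteq> C" "vN_algebra D"
  shows "restrict l D \<in> gelfand D"
  using assms unfolding gelfand_def by (auto simp: vN_algebraD subset_iff)

lemma gelfand_two_dim:
  assumes "projection p" "l \<in> gelfand (two_dim p)"
  shows "l (cscale z p + cscale w (mat 1 - p)) = z * l p + w * (1 - l p)"
proof -
  note vN = vN_algebra_two_dim[OF assms(1)]
  have p: "p \<in> two_dim p" by (rule two_dim_generator)
  have p': "mat 1 - p \<in> two_dim p" using vN p by (intro vN_algebra_diff vN_algebraD)
  show ?thesis
    using p p' vN by (simp add: gelfandD[OF assms(2)] gelfand_compl[OF vN assms(2)] vN_algebraD)
qed

lemma gelfand_two_dim_eqI:
  assumes "projection p" "l \<in> gelfand (two_dim p)" "m \<in> gelfand (two_dim p)" "l p = m p"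
  shows "l = m"
proof (rule extensionalityI[OF gelfandD(1)[OF assms(2)] gelfandD(1)[OF assms(3)]])
  fix x assume "x \<in> two_dim p"
  then show "l x = m x"
    using assms by (auto simp: two_dim_def gelfand_two_dim)
qed

lemma gelfand_two_dim_exists:
  assumes p: "projection p" "p \<noteq> 0"
  shows "\<exists>l\<in>gelfand (two_dim p). l p = 1"
proof -
  \<comment> \<open>The coordinate along \<open>p\<close>, characterised without choosing a
    representation of \<open>x\<close>; it is unique because \<open>p\<close> is nonzero.\<close>
  let ?f = "\<lambda>x. THE z. x ** p = cscale z p"
  let ?l = "restrict ?f (two_dim p)"
  have cancel: "cscale z p = cscale w p \<longleftrightarrow> z = w" for z w
    using p(2) cscale_eq_0_iff[of "z - w" p] by (auto simp: cscale_algebra)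
  have f: "?f (cscale z p + cscale w (mat 1 - p)) = z" for z w
    using p by (simp add: matrix_mul_distribs projectionD cancel)
  have l: "?l (cscale z p + cscale w (mat 1 - p)) = z" for z w
    unfolding restrict_apply'[OF two_dim_memI] by (rule f)
  have "?l p = 1" using l[of 1 0] by simp
  moreover have "?l \<in> gelfand (two_dim p)"
    unfolding gelfand_def
  proof (intro CollectI conjI ballI allI)
    fix x y assume "x \<in> two_dim p" "y \<in> two_dim p"
    then obtain z w z' w' where xy: "x = cscale z p + cscale w (mat 1 - p)"
      "y = cscale z' p + cscale w' (mat 1 - p)" by (auto simp: two_dim_def)
    have "x + y = cscale (z + z') p + cscale (w + w') (mat 1 - p)"
      by (simp add: xy cscale_algebra)
    then show "?l (x + y) = ?l x + ?l y" by (simp only: xy l)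
    show "?l (x ** y) = ?l x * ?l y" by (simp only: xy l two_dim_mult[OF p(1)])
  next
    fix c x assume "x \<in> two_dim p"
    then obtain z w where x: "x = cscale z p + cscale w (mat 1 - p)"
      by (auto simp: two_dim_def)
    have "cscale c x = cscale (c * z) p + cscale (c * w) (mat 1 - p)"
      unfolding x cscale_algebra(1) by simp
    then show "?l (cscale c x) = c * ?l x" by (simp only: x l)
  next
    show "?l (mat 1) = 1" using l[of 1 1] by simp
  qed simp
  ultimately show ?thesis by (rule bexI)
qed

lemma gelfand_two_dim_cases:
  assumes p: "projection p" "p \<noteq> 0" "p \<noteq> mat 1"
  obtains l0 l1 where "gelfand (two_dim p) = {l0, l1}" "l0 p = 0" "l1 p = 1"
proof -
  obtain l1 where l1: "l1 \<in> gelfand (two_dim p)" "l1 p = 1"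
    using gelfand_two_dim_exists p by blast
  \<comment> \<open>\<open>p\<close> and \<open>1 - p\<close> span the same algebra, so the second
    character comes from the existence lemma for \<open>1 - p\<close>.\<close>
  obtain l0 where l0: "l0 \<in> gelfand (two_dim p)" "l0 (mat 1 - p) = 1"
    using gelfand_two_dim_exists[OF projection_compl[OF p(1)]] p unfolding two_dim_compl by auto
  have "l0 p = 0"
    using gelfand_compl[OF vN_algebra_two_dim[OF p(1)] l0(1) two_dim_generator] l0(2) by simp
  moreover have "l = l0 \<or> l = l1" if "l \<in> gelfand (two_dim p)" for l
    using gelfand_projection[OF that two_dim_generator p(1)]
      gelfand_two_dim_eqI[OF p(1) that] l0(1) l1 \<open>l0 p = 0\<close> by metis
  ultimately show ?thesis using that[of l0 l1] l0(1) l1 by blast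
qed

text \<open>Evaluation at \<open>p\<close> is continuous and separates characters. Its values are 0
  and 1, so avoiding the value \<open>1 - l p\<close> isolates \<open>l\<close>.\<close>

lemma openin_gelfand_singleton:
  assumes p: "projection p" and l: "l \<in> gelfand (two_dim p)"
  shows "openin (gelfand_topology (two_dim p)) {l}"
proof -
  have top: "topspace (gelfand_topology (two_dim p)) = gelfand (two_dim p)"
    by (auto simp: gelfand_topology_def gelfand_def PiE_def)
  have cont: "continuous_map (gelfand_topology (two_dim p)) euclidean (\<lambda>m. m p)"
    unfolding gelfand_topology_def
    by (intro continuous_map_from_subtopology continuous_map_product_projection two_dim_generator)
  have "{l} = {m \<in> topspace (gelfand_topology (two_dim p)). m p \<in> - {1 - l p}}"
  proof -
    have "m p \<noteq> 1 - l p \<longleftrightarrow> m = l" if "m \<in> gelfand (two_dim p)" for m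
      using gelfand_projection[OF that two_dim_generator p] gelfand_two_dim_eqI[OF p that l]
        gelfand_projection[OF l two_dim_generator p] by auto
    then show ?thesis using l unfolding top by auto
  qed
  also have "openin (gelfand_topology (two_dim p)) \<dots>"
    by (rule openin_continuous_map_preimage[OF cont]) (simp add: open_Compl)
  finally show ?thesis .
qed

lemma sigma_sets_gelfand_two_dim:
  assumes p: "projection p" "p \<noteq> 0" "p \<noteq> mat 1"
  shows "sigma_sets (gelfand (two_dim p)) {U. openin (gelfand_topology (two_dim p)) U} =
    Pow (gelfand (two_dim p))"
proof
  let ?G = "gelfand (two_dim p)" and ?T = "gelfand_topology (two_dim p)"
  have "{U. openin ?T U} \<subseteq> Pow ?G"
    by (auto dest!: openin_subset simp: gelfand_topology_def)
  then show "sigma_sets ?G {U. openin ?T U} \<subseteq> Pow ?G"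
    by (auto dest: sigma_sets_into_sp)
  show "Pow ?G \<subseteq> sigma_sets ?G {U. openin ?T U}"
  proof
    fix U assume "U \<in> Pow ?G"
    moreover have "openin ?T (\<Union>l\<in>U. {l})" if "U \<subseteq> ?G"
      using that p(1) by (blast intro: openin_gelfand_singleton)
    ultimately show "U \<in> sigma_sets ?G {U. openin ?T U}"
      by (intro sigma_sets.Basic) simp
  qed
qed

section \<open>The Riesz-Markov measure on a two-point spectrum\<close>

lemma state_projection:
  assumes \<psi>: "state \<psi>" and p: "projection p"
  obtains c where "0 \<le> c" "c \<le> 1" "\<psi> p = complex_of_real c" "\<psi> (mat 1 - p) = complex_of_real (1 - c)"
proof -
  have add: "\<psi> (x + y) = \<psi> x + \<psi> y" and pos: "pos x \<Longrightarrow> \<psi> x \<in> \<real>\<^sub>\<ge>\<^sub>0" and "\<psi> (mat 1) = 1" for x y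
    using \<psi> by (auto simp: state_def)
  have "\<psi> p + \<psi> (mat 1 - p) = 1"
    using add[of p "mat 1 - p"] \<open>\<psi> (mat 1) = 1\<close> by simp
  moreover obtain c where c: "\<psi> p = complex_of_real c" "0 \<le> c"
    using pos[OF pos_projection[OF p]] by (auto elim: nonneg_Reals_cases)
  moreover obtain d where "\<psi> (mat 1 - p) = complex_of_real d" "0 \<le> d"
    using pos[OF pos_projection[OF projection_compl[OF p]]] by (auto elim: nonneg_Reals_cases)
  ultimately have "\<psi> (mat 1 - p) = complex_of_real d" "0 \<le> d" "c + d = 1"
    by (metis of_real_add of_real_eq_1_iff)+
  moreover from this have "d = 1 - c" by simp
  ultimately show ?thesis using c by (intro that[of c]) simp_all
qed

text \<open>The \<open>THE\<close> in \<open>riesz_measure\<close> requires existence and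
  uniqueness. The integral condition at \<open>p\<close> fixes the masses of both points, and the
  point measure with these masses satisfies it on the whole algebra by linearity.\<close>

lemma measure_riesz_two_dim:
  assumes \<psi>: "state \<psi>" and p: "projection p" "p \<noteq> 0" "p \<noteq> mat 1"
  shows "measure (riesz_measure \<psi> (two_dim p)) {l \<in> gelfand (two_dim p). l p = 0} = 1 - Re (\<psi> p)"
proof -
  obtain l0 l1 where G: "gelfand (two_dim p) = {l0, l1}" and l: "l0 p = 0" "l1 p = 1"
    using gelfand_two_dim_cases[OF p] .
  obtain c where c: "0 \<le> c" "c \<le> 1" "\<psi> p = complex_of_real c" "\<psi> (mat 1 - p) = complex_of_real (1 - c)"
    using state_projection[OF \<psi> p(1)] .
  have ne: "l0 \<noteq> l1" using l by auto
  define P where "P = (\<lambda>M. prob_space M \<and> space M = gelfand (two_dim p) \<and>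
     sets M = sigma_sets (gelfand (two_dim p)) {U. openin (gelfand_topology (two_dim p)) U} \<and>
     (\<forall>x\<in>two_dim p. (\<integral>l. l x \<partial>M) = \<psi> x))"
  have sig: "sigma_sets {l0, l1} {U. openin (gelfand_topology (two_dim p)) U} = Pow {l0, l1}"
    using sigma_sets_gelfand_two_dim[OF p] unfolding G .
  have P: "P M \<longleftrightarrow> prob_space M \<and> space M = {l0, l1} \<and> sets M = Pow {l0, l1} \<and>
      (\<forall>x\<in>two_dim p. (\<integral>l. l x \<partial>M) = \<psi> x)" for M
    by (simp only: P_def G sig)
  have val: "measure M {l1} = c \<and> measure M {l0} = 1 - c" if "P M" for M
  proof -
    interpret prob_space M using that by (simp add: P)
    have sp: "space M = {l0, l1}" "sets M = Pow {l0, l1}" using that by (simp_all add: P)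
    have "complex_of_real c = (\<integral>l. l p \<partial>M)"
      using that two_dim_generator[of p] c by (simp add: P)
    \<comment> \<open>Evaluation at \<open>p\<close> is the indicator of \<open>{l1}\<close> on the
      spectrum.\<close>
    also have "\<dots> = (\<integral>l. complex_of_real (indicator {l1} l) \<partial>M)"
      by (rule Bochner_Integration.integral_cong) (use sp l ne in auto)
    also have "\<dots> = complex_of_real (measure M {l1})"
      using sp by (simp add: integral_complex_of_real)
    finally have 1: "measure M {l1} = c" by simp
    have "{l0} = space M - {l1}" using sp ne by auto
    then have "measure M {l0} = 1 - measure M {l1}"
      using prob_compl[of "{l1}"] sp by simp
    with 1 show ?thesis by simp
  qed
  have "P (point_measure {l0, l1} (\<lambda>l. if l = l1 then c else 1 - c))" (is "P ?M")
    unfolding P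
  proof (intro conjI ballI)
    show "prob_space ?M"
      by (rule prob_spaceI)
        (use c ne in \<open>simp add: space_point_measure emeasure_point_measure_finite ennreal_plus[symmetric] del: ennreal_plus\<close>)
    fix x assume "x \<in> two_dim p"
    then obtain z w where x: "x = cscale z p + cscale w (mat 1 - p)"
      by (auto simp: two_dim_def)
    have "l0 x = w" "l1 x = z"
      unfolding x using gelfand_two_dim[OF p(1), of l0] gelfand_two_dim[OF p(1), of l1] G l by simp_all
    moreover have "\<psi> x = z * \<psi> p + w * \<psi> (mat 1 - p)"
      using \<psi> unfolding x state_def by metis
    ultimately show "(\<integral>l. l x \<partial>?M) = \<psi> x"
      using c ne by (simp add: lebesgue_integral_point_measure_finite scaleR_conv_of_real mult.commute)
  qed (simp_all add: space_point_measure sets_point_measure)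
  moreover have "M = N" if "P M" "P N" for M N
  proof (rule measure_eqI_finite)
    interpret M: prob_space M using that by (simp add: P)
    interpret N: prob_space N using that by (simp add: P)
    fix a assume "a \<in> {l0, l1}"
    then show "emeasure M {a} = emeasure N {a}"
      using val[OF that(1)] val[OF that(2)]
      by (auto simp: M.emeasure_eq_measure N.emeasure_eq_measure)
  qed (use that in \<open>simp_all add: P\<close>)
  ultimately have "P (THE M. P M)" by (metis theI)
  moreover have "riesz_measure \<psi> (two_dim p) = (THE M. P M)"
    unfolding riesz_measure_def P_def ..
  moreover have "{l \<in> gelfand (two_dim p). l p = 0} = {l0}" using G l by auto
  ultimately show ?thesis using val c(3) by simp
qed

section \<open>Stalks of the negated elementary proposition\<close>

text \<open>An open set disjoint from \<open>U\<close> that contains the point is closed under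
  restriction, so the restricted characters avoid \<open>U\<close> as well.\<close>

lemma negD:
  assumes "(C, l) \<in> neg U"
  shows "C \<in> contexts" "l \<in> gelfand C"
    and "D \<in> contexts \<Longrightarrow> D \<subseteq> C \<Longrightarrow> (D, restrict l D) \<notin> U"
  using assms unfolding neg_def opens_def Sigma_down_def by blast+

text \<open>Tests the negation at the context \<open>two_dim q\<close>, where the daseinisation is
  explicit. It cannot be \<open>1\<close>, on which every character takes the value 1.\<close>

lemma neg_elem_prop_projection:
  assumes e: "projection (spectral_proj \<Delta> a)" "spectral_proj \<Delta> a \<noteq> 0"
    and C: "(C, l) \<in> neg (elem_prop a \<Delta>)"
    and q: "q \<in> C" "projection q" "q \<noteq> 0" "q \<noteq> mat 1"
  shows "l q = 0 \<and> spectral_proj \<Delta> a \<preceq> q \<or> l q = 1 \<and> spectral_proj \<Delta> a \<preceq> mat 1 - q"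
proof -
  let ?e = "spectral_proj \<Delta> a" and ?D = "two_dim q"
  have vN: "vN_algebra C" using negD(1)[OF C] by (rule contexts_vN_algebra)
  have D: "?D \<in> contexts" "?D \<subseteq> C"
    using two_dim_context[OF q(2-4)] two_dim_subset[OF vN q(1)] .
  have l: "restrict l ?D \<in> gelfand ?D"
    using gelfand_restrict[OF negD(2)[OF C] D(2) vN_algebra_two_dim[OF q(2)]] .
  have val: "restrict l ?D (outer_das ?e ?D) \<noteq> 1"
    using negD(3)[OF C D] D(1) l by (simp add: elem_prop_def Sigma_down_def)
  have lq: "l q = 0 \<or> l q = 1" using gelfand_projection[OF negD(2)[OF C] q(1,2)] .
  have mem: "q \<in> ?D" "mat 1 - q \<in> ?D" "mat 1 \<in> ?D"
    using two_dim_generator[of q] two_dim_generator[of "mat 1 - q"]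
      vN_algebraD(1)[OF vN_algebra_two_dim[OF q(2)]] by (simp_all add: two_dim_compl)
  consider "?e \<preceq> q" | "?e \<preceq> mat 1 - q" | "\<not> ?e \<preceq> q" "\<not> ?e \<preceq> mat 1 - q" by blast
  then show ?thesis
  proof cases
    case 1
    then show ?thesis
      using outer_das_two_dim_above[OF e q(2) 1] val mem lq by simp
  next
    case 2
    have "outer_das ?e ?D = mat 1 - q"
      using outer_das_two_dim_above[OF e projection_compl[OF q(2)] 2] by (simp add: two_dim_compl)
    then show ?thesis
      using 2 val mem lq gelfand_compl[OF vN negD(2)[OF C] q(1)] by auto
  next
    case 3
    then show ?thesis
      using outer_das_two_dim_else[OF e q(2) 3] val mem gelfandD(5)[OF negD(2)[OF C]] by simp
  qed
qed

text \<open>Two distinct nontrivial projections \<open>p\<close>, \<open>q\<close> on which \<open>l\<close> vanishes cannot both dominate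
  \<open>\<chi>\<^sub>\<Delta>(a)\<close>: \<open>l\<close> also vanishes on \<open>p - pq\<close>, which would then dominate it as well, although it is
  orthogonal to \<open>q\<close>.\<close>

lemma neg_elem_prop_nonempty:
  assumes e: "projection (spectral_proj \<Delta> a)" "spectral_proj \<Delta> a \<noteq> 0"
    and C: "(C, l) \<in> neg (elem_prop a \<Delta>)"
  shows "\<exists>p. projection p \<and> p \<noteq> mat 1 \<and> spectral_proj \<Delta> a \<preceq> p \<and> C = two_dim p"
proof -
  let ?e = "spectral_proj \<Delta> a"
  note ctx = negD(1)[OF C] and l = negD(2)[OF C] and main = neg_elem_prop_projection[OF e C]
  have vN: "vN_algebra C" and comm: "\<And>x y. x \<in> C \<Longrightarrow> y \<in> C \<Longrightarrow> x ** y = y ** x"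
    using ctx by (auto simp: contexts_def)
  have compl: "mat 1 - q \<in> C" if "q \<in> C" for q
    using vN that by (intro vN_algebra_diff vN_algebraD)
  \<comment> \<open>This is \<open>q\<close> below \<open>r\<close>. Exchanging the two projections
    and using commutativity in \<open>C\<close> gives their equality in \<open>eq\<close>.\<close>
  have below: "q = q ** r"
    if q: "q \<in> C" "projection q" "q \<noteq> mat 1" "l q = 0"
      and r: "r \<in> C" "projection r" "r \<noteq> 0" "r \<noteq> mat 1" "l r = 0" for q r
  proof (rule ccontr)
    assume "q \<noteq> q ** r"
    let ?s = "q ** (mat 1 - r)"
    have s: "?s \<in> C" "projection ?s"
      using q r compl comm vN by (auto intro!: vN_algebraD projection_mult projection_compl)
    have "?s \<noteq> 0" using \<open>q \<noteq> q ** r\<close> by (simp add: matrix_mul_distribs)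
    moreover have "?s \<noteq> mat 1"
    proof
      assume "?s = mat 1"
      moreover have "q ** ?s = ?s" by (rule projectionD_assoc[OF q(2)])
      ultimately show False using q(3) by (metis matrix_mul_rid)
    qed
    moreover have "l ?s = 0"
      using gelfandD(3)[OF l q(1) compl[OF r(1)]] q(4) by simp
    ultimately have "?e \<preceq> ?s" using main[OF s] by auto
    then have "?s ** ?e = ?e" using e s by (simp add: le_op_projection_iff)
    have "?e \<preceq> r" using main[OF r(1-4)] r(5) by auto
    then have "r ** ?e = ?e" using e r by (simp add: le_op_projection_iff)
    then have "?s ** ?e = 0"
      by (simp add: matrix_mul_assoc[symmetric] matrix_mul_distribs)
    with \<open>?s ** ?e = ?e\<close> e show False by simp
  qed
  obtain q where q: "q \<in> C" "projection q" "q \<noteq> 0" "q \<noteq> mat 1"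
    using context_exists_projection[OF ctx] by blast
  \<comment> \<open>Where \<open>l q = 1\<close>, the complement of \<open>q\<close> is taken
    instead.\<close>
  obtain p where p: "p \<in> C" "projection p" "p \<noteq> 0" "p \<noteq> mat 1" "l p = 0"
  proof (cases "l q = 0")
    case False
    then have "l (mat 1 - q) = 0"
      using gelfand_projection[OF l q(1,2)] gelfand_compl[OF vN l q(1)] by simp
    then show ?thesis using that[OF compl[OF q(1)] projection_compl[OF q(2)]] q by auto
  qed (use q that in blast)
  have eq: "r = p" if "r \<in> C" "projection r" "r \<noteq> 0" "r \<noteq> mat 1" "l r = 0" for r
    using below[OF that(1,2,4,5) p] below[OF p(1,2,4,5) that] comm[OF that(1) p(1)] by simp
  have "C = two_dim p"
  proof (rule context_eq_two_dim[OF ctx p(1-4)])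
    fix r assume r: "r \<in> C" "projection r"
    show "r \<in> {0, p, mat 1 - p, mat 1}"
    proof (cases "r = 0 \<or> r = mat 1")
      case False
      show ?thesis
      proof (cases "l r = 0")
        case True
        then show ?thesis using eq[OF r] False by auto
      next
        case neq: False
        then have "l (mat 1 - r) = 0"
          using gelfand_projection[OF l r] gelfand_compl[OF vN l r(1)] by simp
        then have "mat 1 - r = p"
          using eq[OF compl[OF r(1)] projection_compl[OF r(2)]] False by auto
        then have "r = mat 1 - p" by auto
        then show ?thesis by simp
      qed
    qed auto
  qed
  moreover have "?e \<preceq> p" using main[OF p(1-4)] p(5) by auto
  ultimately show ?thesis using p by blast
qed

text \<open>Only \<open>two_dim p\<close> itself lies below this context, and the daseinisation
  there is \<open>p\<close>; thus the negation just excludes the value 1 at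
  \<open>p\<close>.\<close>

lemma fibre_neg_elem_prop:
  assumes e: "projection (spectral_proj \<Delta> a)" "spectral_proj \<Delta> a \<noteq> 0"
    and p: "projection p" "p \<noteq> 0" "p \<noteq> mat 1" "spectral_proj \<Delta> a \<preceq> p"
  shows "fibre (neg (elem_prop a \<Delta>)) (two_dim p) = {l \<in> gelfand (two_dim p). l p = 0}"
proof (intro equalityI subsetI)
  fix l assume "l \<in> fibre (neg (elem_prop a \<Delta>)) (two_dim p)"
  then have C: "(two_dim p, l) \<in> neg (elem_prop a \<Delta>)" by (simp add: fibre_def)
  have "restrict l (two_dim p) = l"
    using gelfandD(1)[OF negD(2)[OF C]] by (rule extensional_restrict)
  then have "l p \<noteq> 1"
    using negD(3)[OF C negD(1)[OF C]] negD(1,2)[OF C] outer_das_two_dim_above[OF e p(1,4)]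
    by (simp add: elem_prop_def Sigma_down_def)
  then show "l \<in> {l \<in> gelfand (two_dim p). l p = 0}"
    using gelfand_projection[OF negD(2)[OF C] two_dim_generator p(1)] negD(2)[OF C] by auto
next
  fix l assume "l \<in> {l \<in> gelfand (two_dim p). l p = 0}"
  then have l: "l \<in> gelfand (two_dim p)" "l p = 0" by auto
  \<comment> \<open>By minimality of the context and discreteness of its spectrum, a single point is
    already open.\<close>
  let ?V = "{(two_dim p, l)}"
  have "restrict l (two_dim p) = l"
    using gelfandD(1)[OF l(1)] by (rule extensional_restrict)
  moreover have "fibre ?V D = (if D = two_dim p then {l} else {})" for D
    by (auto simp: fibre_def)
  ultimately have "?V \<in> opens"
    using l two_dim_context[OF p(1-3)] context_subset_two_dim[OF p(1)] openin_gelfand_singleton[OF p(1)]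
    by (auto simp: opens_def Sigma_down_def)
  moreover have "?V \<inter> elem_prop a \<Delta> = {}"
    using l outer_das_two_dim_above[OF e p(1,4)] by (simp add: elem_prop_def)
  ultimately show "l \<in> fibre (neg (elem_prop a \<Delta>)) (two_dim p)"
    unfolding fibre_def neg_def by blast
qed

theorem proposition4p4:
  fixes \<psi> :: "'n::finite cmat \<Rightarrow> complex"
    and a :: "'n cmat"
    and \<Delta> :: "real set"
    and C :: "'n cmat set"
  assumes "state \<psi>"
    and "selfadj a"
    and "open \<Delta>"
    and "spectral_proj \<Delta> a \<noteq> 0"
    and "C \<in> contexts"
  shows "forces_eq C (mu \<psi> (neg (elem_prop a \<Delta>))) (\<lambda>_. 1) \<longleftrightarrow>
    (\<exists>p\<in>C. projection p \<and> generates p C \<and> spectral_proj \<Delta> a \<preceq> p \<and> \<psi> p = 0)"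
proof -
  note e = projection_spectral_proj[OF assms(2)] assms(4)
  have nonzero: "p \<noteq> 0" if "projection p" "spectral_proj \<Delta> a \<preceq> p" for p
    using that e le_op_projection_iff by fastforce
  have mu: "mu \<psi> (neg (elem_prop a \<Delta>)) (two_dim p) = 1 \<longleftrightarrow> \<psi> p = 0"
    if p: "projection p" "p \<noteq> mat 1" "spectral_proj \<Delta> a \<preceq> p" for p
  proof -
    obtain c where "\<psi> p = complex_of_real c" using state_projection[OF assms(1) p(1)] .
    then show ?thesis
      using p nonzero[OF p(1,3)]
      by (simp add: mu_def fibre_neg_elem_prop[OF e] measure_riesz_two_dim[OF assms(1)])
  qed
  show ?thesis
  proof
    assume "forces_eq C (mu \<psi> (neg (elem_prop a \<Delta>))) (\<lambda>_. 1)"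
    then have 1: "mu \<psi> (neg (elem_prop a \<Delta>)) C = 1"
      using assms(5) by (simp add: forces_eq_def)
    \<comment> \<open>An empty stalk would have measure 0, not 1.\<close>
    then obtain l where "(C, l) \<in> neg (elem_prop a \<Delta>)"
      by (cases "fibre (neg (elem_prop a \<Delta>)) C = {}") (auto simp: mu_def fibre_def)
    from neg_elem_prop_nonempty[OF e this] obtain p where
      p: "projection p" "p \<noteq> mat 1" "spectral_proj \<Delta> a \<preceq> p" "C = two_dim p" by blast
    then show "\<exists>p\<in>C. projection p \<and> generates p C \<and> spectral_proj \<Delta> a \<preceq> p \<and> \<psi> p = 0"
      using 1 mu[OF p(1-3)] generates_iff[OF p(1)] two_dim_generator by blast
  next
    assume "\<exists>p\<in>C. projection p \<and> generates p C \<and> spectral_proj \<Delta> a \<preceq> p \<and> \<psi> p = 0"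
    then obtain p where p: "projection p" "C = two_dim p" "spectral_proj \<Delta> a \<preceq> p" "\<psi> p = 0"
      using generates_iff by blast
    \<comment> \<open>A state has value 1 at the unit, whereas \<open>\<psi> p = 0\<close>.\<close>
    have "p \<noteq> mat 1" using p(4) assms(1) by (auto simp: state_def)
    \<comment> \<open>Minimality reduces the stages below \<open>C\<close> to \<open>C\<close>
      itself.\<close>
    then show "forces_eq C (mu \<psi> (neg (elem_prop a \<Delta>))) (\<lambda>_. 1)"
      using mu[OF p(1) _ p(3)] p(4) context_subset_two_dim[OF p(1)]
      unfolding forces_eq_def p(2) by metis
  qed
qed

end
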